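(* As $H\to\infty$, $$C_{\mathrm{constr}}(H)\gg H\log H,$$ where $C_{\mathrm{constr}}(H)$ is the number of pairs of integers $(p,r)$ with $p>r\ge 2$ such that the solution $A=\{\pm(pr-1),\pm(p+r)\}$, $B=\{\pm(pr+1),\pm(p-r)\}$ has height at most $H$.
   Context: For integers $p>r\ge2$, the four-element multisets $A=\{\pm(pr-1),\pm(p+r)\}$ and $B=\{\pm(pr+1),\pm(p-r)\}$ (where $\{\pm x,\pm y\}=\{x,-x,y,-y\}$) form a degree-three Prouhet--Tarry--Escott solution, i.e. have equal sums of $\ell$-th powers for $\ell=1,2,3$. The height of $(A,B)$ is $\max\{|a|,|b|:a\in A,\ b\in B\}$. Solutions are counted by parameter pairs $(p,r)$. The notation $f(H)\gg g(H)$ as $H\to\infty$ means that there are constants $\kappa>0$ and $H_0$ with $f(H)\ge \kappa\, g(H)$ for all $H\ge H_0$. *)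

theory Defs
  imports Complex_Main "HOL-Library.Multiset"
begin

definition pte_solution :: "nat \<Rightarrow> int multiset \<Rightarrow> int multiset \<Rightarrow> bool" where
  "pte_solution k A B \<longleftrightarrow>
     (\<forall>l\<in>{1..k}. (\<Sum>a\<in>#A. a ^ l) = (\<Sum>b\<in>#B. b ^ l))"

definition pm2 :: "int \<Rightarrow> int \<Rightarrow> int multiset" where
  "pm2 x y = {#x, -x, y, -y#}"

definition constr_A :: "int \<Rightarrow> int \<Rightarrow> int multiset" where
  "constr_A p r = pm2 (p * r - 1) (p + r)"

definition constr_B :: "int \<Rightarrow> int \<Rightarrow> int multiset" where
  "constr_B p r = pm2 (p * r + 1) (p - r)"

lemma pte_solution_constr: "pte_solution 3 (constr_A p r) (constr_B p r)"
proof -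
  have "{1..3::nat} = {1, 2, 3}"
    by auto
  then show ?thesis
    unfolding pte_solution_def constr_A_def constr_B_def pm2_def
    by (simp add: power2_eq_square power3_eq_cube algebra_simps)
qed

text \<open>The height is meaningful when at least one of the multisets is non-empty.\<close>

definition height :: "int multiset \<Rightarrow> int multiset \<Rightarrow> int" where
  "height A B = Max (abs ` (set_mset A \<union> set_mset B))"

definition constr_pairs :: "real \<Rightarrow> (int \<times> int) set" where
  "constr_pairs H = {(p, r). p > r \<and> r \<ge> 2 \<and>
     real_of_int (height (constr_A p r) (constr_B p r)) \<le> H}"

definition C_constr :: "real \<Rightarrow> nat" where
  "C_constr H = card (constr_pairs H)"

text \<open>The set being counted is finite, so its \<^const>\<open>card\<close> is the actual number of pairs.\<close>

lemma finite_constr_pairs: "finite (constr_pairs H)"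
proof (rule finite_subset)
  show "constr_pairs H \<subseteq> {0..\<lfloor>H\<rfloor>} \<times> {0..\<lfloor>H\<rfloor>}"
  proof (clarify)
    fix p r assume "(p, r) \<in> constr_pairs H"
    then have pr: "p > r" "r \<ge> 2"
      and le: "real_of_int (height (constr_A p r) (constr_B p r)) \<le> H"
      by (auto simp: constr_pairs_def)
    have "\<bar>p + r\<bar> \<le> height (constr_A p r) (constr_B p r)"
      unfolding height_def by (rule Max_ge) (auto simp: constr_A_def pm2_def)
    moreover have "height (constr_A p r) (constr_B p r) \<le> \<lfloor>H\<rfloor>"
      using le by (simp add: le_floor_iff)
    ultimately show "p \<in> {0..\<lfloor>H\<rfloor>} \<and> r \<in> {0..\<lfloor>H\<rfloor>}"
      using pr by auto
  qed
qed simp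

end

theory Submission
  imports Defs "HOL-Analysis.Harmonic_Numbers"
begin

text \<open>
  For \<open>p > r \<ge> 2\<close> the height is \<open>p r + 1\<close>, so the count is a divisor-type sum over the region
  \<open>p r \<le> H - 1\<close>. For each \<open>r\<close> up to a small multiple of \<open>\<surd>H\<close>, every
  \<open>p\<close> with \<open>r < p \<le> H / (2 r)\<close> is admissible, which gives at least \<open>H / (4 r)\<close> values of \<open>p\<close>;
  summing over \<open>r\<close> yields a harmonic sum of size about \<open>(ln H) / 2\<close>.
\<close>

text \<open>Expanding \<open>(p - 1) * (r - 1) \<ge> 0\<close> gives
  \<open>p + r \<le> p * r + 1\<close>, so the entry \<open>p * r + 1\<close> of \<open>B\<close>
  dominates all the others.\<close>

lemma height_constr:
  assumes "p > r" "r \<ge> 2"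
  shows "height (constr_A p r) (constr_B p r) = p * r + 1"
proof -
  have "(p - 1) * (r - 1) \<ge> 0"
    using assms by (intro mult_nonneg_nonneg) auto
  then have sum_le: "p + r \<le> p * r + 1"
    by (simp add: algebra_simps)
  moreover have "p * r \<ge> 1"
    using assms sum_le by linarith
  ultimately show ?thesis
    using assms unfolding height_def constr_A_def constr_B_def pm2_def
    by (intro Max_eqI) auto
qed

text \<open>With \<open>x = H / (16 * real r)\<close>, the bound on \<open>r\<close> says
  \<open>1 \<le> r \<le> x\<close>. The interval holds at least
  \<open>8 * x - 1 - r \<ge> 6 * x\<close> integers, more than the required
  \<open>4 * x\<close>.\<close>

lemma card_admissible_ge:
  fixes H :: real and r :: nat
  assumes "r \<ge> 1" "real r \<le> sqrt H / 4"
  shows "real (card {int r<..\<lfloor>H / (2 * real r)\<rfloor>}) \<ge> H / (4 * real r)"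
proof -
  have "H > 0"
  proof -
    have "sqrt H > 0"
      using assms by linarith
    then show ?thesis
      by simp
  qed
  have "(real r)\<^sup>2 \<le> (sqrt H / 4)\<^sup>2"
    using assms by (intro power_mono) auto
  then have "real r * real r \<le> H / 16"
    using \<open>H > 0\<close> by (simp add: power2_eq_square)
  then have r_le: "real r \<le> H / (16 * real r)"
    using assms by (simp add: field_simps)
  define x where "x = H / (16 * real r)"
  have "real_of_int \<lfloor>H / (2 * real r)\<rfloor> \<ge> 8 * x - 1"
    using floor_correct[of "H / (2 * real r)"] by (simp add: x_def)
  moreover have "H / (4 * real r) = 4 * x"
    by (simp add: x_def)
  moreover have "real r \<le> x" "real r \<ge> 1"
    using r_le assms by (auto simp: x_def)
  ultimately show ?thesis
    by simp
qed

text \<open>Sums the bounds for the single \<open>r\<close>; the \<open>- 1\<close> removes the term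
  \<open>r = 1\<close> of the harmonic sum, since admissible pairs have
  \<open>r \<ge> 2\<close>.\<close>

lemma C_constr_ge_harm:
  assumes "real m \<le> sqrt H / 4" "m \<ge> 1"
  shows "real (C_constr H) \<ge> H / 4 * (harm m - 1)"
proof -
  define P where "P = (\<lambda>r::nat. {int r<..\<lfloor>H / (2 * real r)\<rfloor>})"
  have "4 \<le> sqrt H"
    using assms by linarith
  then have "4\<^sup>2 \<le> (sqrt H)\<^sup>2"
    by (intro power_mono) auto
  moreover have "H > 0"
    using \<open>4 \<le> sqrt H\<close> real_sqrt_gt_0_iff[of H] by linarith
  ultimately have "H \<ge> 16"
    by simp
  \<comment> \<open>The swap puts \<open>p\<close> first, as in \<open>constr_pairs\<close>; being
    injective, it preserves cardinality.\<close>
  define f where "f = (\<lambda>(r::nat, p::int). (p, int r))"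
  have "f ` (SIGMA r:{2..m}. P r) \<subseteq> constr_pairs H"
  proof (rule image_subsetI)
    fix z assume "z \<in> (SIGMA r:{2..m}. P r)"
    then obtain r p where z: "z = (r, p)" and r: "r \<in> {2..m}" and p: "p \<in> P r"
      by blast
    have "real_of_int p \<le> H / (2 * real r)"
      using p by (simp add: P_def le_floor_iff)
    then have "real_of_int p * real r \<le> H / 2"
      using r by (simp add: field_simps)
    \<comment> \<open>The factor 2 in the cutoff for \<open>p\<close> leaves room for the
      \<open>+ 1\<close> in the height.\<close>
    then have "real_of_int (p * int r + 1) \<le> H"
      using \<open>H \<ge> 16\<close> by simp
    then show "f z \<in> constr_pairs H"
      using r p height_constr[of "int r" p] by (simp add: z f_def constr_pairs_def P_def)
  qed
  then have "card (f ` (SIGMA r:{2..m}. P r)) \<le> C_constr H"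
    unfolding C_constr_def by (intro card_mono finite_constr_pairs)
  moreover have "inj f"
    by (auto simp: f_def inj_def)
  ultimately have "card (SIGMA r:{2..m}. P r) \<le> C_constr H"
    by (metis card_image inj_on_subset subset_UNIV)
  then have "(\<Sum>r=2..m. card (P r)) \<le> C_constr H"
    by (subst (asm) card_SigmaI) (simp_all add: P_def)
  moreover have "(\<Sum>r=2..m. H / (4 * real r)) \<le> (\<Sum>r=2..m. real (card (P r)))"
    unfolding P_def using assms by (intro sum_mono card_admissible_ge) auto
  moreover have "harm m = 1 + (\<Sum>r=2..m. inverse (real r))"
    using assms unfolding harm_def by (subst sum.atLeast_Suc_atMost) (auto simp: numeral_2_eq_2)
  then have "(\<Sum>r=2..m. H / (4 * real r)) = H / 4 * (harm m - 1)"
    by (simp add: sum_distrib_left inverse_eq_divide)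
  moreover have "(\<Sum>r=2..m. real (card (P r))) = real (\<Sum>r=2..m. card (P r))"
    by simp
  ultimately show ?thesis
    by linarith
qed

theorem proposition3p2:
  shows "\<exists>\<kappa>::real. \<kappa> > 0 \<and>
    (\<exists>H0::real. \<forall>H::real. H \<ge> H0 \<longrightarrow> real (C_constr H) \<ge> \<kappa> * (H * ln H))"
proof (intro exI conjI allI impI)
  fix H :: real assume H: "H \<ge> exp 16"
  have "H > 0"
    using H exp_gt_zero[of 16] by linarith
  have "ln H \<ge> 16"
    using H \<open>H > 0\<close> by (simp add: ln_ge_iff)
  have "H \<ge> 16"
    using H exp_ge_add_one_self[of 16] by linarith
  define m where "m = nat \<lfloor>sqrt H / 4\<rfloor>"
  have "sqrt H \<ge> 4"
    using \<open>H \<ge> 16\<close> by (intro real_le_rsqrt) auto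
  \<comment> \<open>Rounding down loses less than 1, which fits the bound
    \<open>ln (m + 1) \<le> harm m\<close>.\<close>
  then have m: "m \<ge> 1" "real m \<le> sqrt H / 4" "sqrt H / 4 \<le> real (m + 1)"
    unfolding m_def by linarith+
  have "ln (sqrt H / 4) \<le> ln (real (m + 1))"
    using m \<open>H > 0\<close> by (subst ln_le_cancel_iff) auto
  also have "\<dots> \<le> harm m"
    using ln_le_harm[of m] by (simp add: add.commute)
  also have "ln (sqrt H / 4) = ln H / 2 - ln 4"
    using \<open>H > 0\<close> by (simp add: ln_div ln_sqrt)
  \<comment> \<open>Half of \<open>ln H / 2\<close> must absorb \<open>ln 4 + 1 \<le> 4\<close>;
    this is why \<open>H\<close> starts at \<open>exp 16\<close>. The two factors 1/4 then give
    \<kappa> = 1/16.\<close>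
  finally have "harm m - 1 \<ge> ln H / 4"
    using \<open>ln H \<ge> 16\<close> ln_le_minus_one[of 4] by simp
  then have "H / 4 * (ln H / 4) \<le> H / 4 * (harm m - 1)"
    using \<open>H > 0\<close> by (intro mult_left_mono) auto
  also have "\<dots> \<le> real (C_constr H)"
    using m by (intro C_constr_ge_harm)
  finally show "1 / 16 * (H * ln H) \<le> real (C_constr H)"
    by simp
qed simp

end
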